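(* Let $k\ge n$. The number of paths of length $n$ from vertex $(0,0)$ to vertex $(i,j)$ in the directed graph $D_k$ is $$\frac{(i+1)(j+2)(j-i+1)\,n!}{\left(\frac{n-i+2j+6}{3}\right)!\,\left(\frac{n+2i-j+3}{3}\right)!\,\left(\frac{n-i-j}{3}\right)!},$$ where $(n-i+2j)/3$ is a positive integer. Otherwise, there is no such path.
   Context: The directed graph $D_k$ has vertex set $V_k=\{(i,j): i,j\in\mathbb{Z}_{\ge 0},\ i+j\le k\}$. There is a directed edge from $(a,b)\in V_k$ to $(c,d)\in V_k$ exactly when $(c,d)$ is one of $(a,b+1)$, $(a-1,b)$, $(a+1,b-1)$. A path of length $n$ in $D_k$ is a sequence of vertices $v_0,v_1,\ldots,v_n$ such that $(v_l,v_{l+1})$ is a directed edge for each $0\le l<n$; vertices may repeat.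
   Formalization: As printed this is false (n=k=2: (1,0) is reachable, yet (n-i+2j)/3 is no integer). Proved with j replaced by i+j in the formula and the condition; the condition reads: (n+i+2j)/3 is an integer (zero allowed) and 2i+j ≤ n; otherwise there is no path. *)

theory Defs
  imports Complex_Main "Graph_Theory.Pair_Digraph" "Graph_Theory.Vertex_Walk"
begin

(* The steps (a-1, b) and (a+1, b-1) are written with Suc so that truncated
   subtraction on nat creates no spurious arcs at a = 0 or b = 0. *)
definition D :: "nat \<Rightarrow> (nat \<times> nat) pair_pre_digraph" where
  "D k = \<lparr> pverts = {(i, j). i + j \<le> k},
           parcs = {((a, b), (c, d)). a + b \<le> k \<and> c + d \<le> k \<and>
             (c = a \<and> d = Suc b \<or> Suc c = a \<and> d = b \<or> c = Suc a \<and> Suc d = b)} \<rparr>"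

(* Paths may revisit vertices, so they are the library's vwalks, not its vpaths. *)
definition paths_of_length ::
  "'a pair_pre_digraph \<Rightarrow> nat \<Rightarrow> 'a \<Rightarrow> 'a \<Rightarrow> 'a vwalk set" where
  "paths_of_length G n u v =
     {p. vwalk p (with_proj G) \<and> vwalk_length p = n \<and> hd p = u \<and> last p = v}"

end

theory Submission
  imports Defs
begin

text \<open>
  Reading a path in \<open>D k\<close> step by step amounts to filling a standard Young tableau. If \<open>A\<close>, \<open>C\<close> and
  \<open>B\<close> count the steps \<open>(0, +1)\<close>, \<open>(+1, -1)\<close> and \<open>(-1, 0)\<close> made so far, then the current vertex
  is \<open>(C - B, A - C)\<close>, so staying in the quadrant means exactly \<open>A \<ge> C \<ge> B\<close>. A path of length
  \<open>n\<close> is therefore a standard tableau of shape \<open>(A, C, B)\<close> with \<open>n = A + C + B\<close> cells. For a path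
  ending at \<open>(i, j)\<close> the shape is \<open>(b + i + j, b + i, b)\<close> with \<open>n = 3 * b + 2 * i + j\<close>, which gives
  the divisibility and size conditions, and the formula of the theorem is Frobenius' count of
  these tableaux. The bound of \<open>D k\<close> never interferes: the coordinate sum is \<open>A - B\<close>, and
  \<open>A - B \<le> n \<le> k\<close>.

  The formal proof needs no tableaux. Removing the last step expresses the number of paths of
  length \<open>n + 1\<close> into a vertex through those of length \<open>n\<close> into its at most three in-neighbours
  (lemma \<open>card_paths_D_Suc\<close>). Frobenius' formula satisfies the same recurrence (lemma
  \<open>three_row_tableaux_rec\<close>, removal of a corner cell), and induction on \<open>n\<close> identifies the two.
\<close>

section \<open>Paths by their last step\<close>

lemma paths_of_length_Suc:
  "paths_of_length G (Suc n) u v =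
     (\<Union>w \<in> {w. (w, v) \<in> parcs G \<and> v \<in> pverts G}. (\<lambda>p. p @ [v]) ` paths_of_length G n u w)"
  (is "?L = ?R")
proof (intro equalityI subsetI)
  fix p assume "p \<in> ?L"
  then have p: "vwalk p (with_proj G)" "length p = Suc (Suc n)" "hd p = u" "last p = v"
    by (auto simp: paths_of_length_def)
  define q where "q = butlast p"
  from p have q: "p = q @ [v]" "length q = Suc n" "q \<noteq> []"
    by (auto simp: q_def simp flip: append_butlast_last_id length_0_conv)
  from p q have "(last q, v) \<in> parcs G" "v \<in> pverts G" "q \<in> paths_of_length G n u (last q)"
    by (auto simp: paths_of_length_def vwalk_def vwalk_arcs_append)
  with q(1) show "p \<in> ?R" by blast
next
  fix p assume "p \<in> ?R"
  then show "p \<in> ?L"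
    by (auto simp: paths_of_length_def vwalk_def vwalk_arcs_append Suc_diff_Suc)
qed

lemma in_paths_of_length_last: "p \<in> paths_of_length G n u v \<Longrightarrow> last p = v"
  by (simp add: paths_of_length_def)

lemma finite_paths_of_length:
  assumes "finite (pverts G)"
  shows "finite (paths_of_length G n u v)"
proof (rule finite_subset)
  show "paths_of_length G n u v \<subseteq> {p. set p \<subseteq> pverts G \<and> length p \<le> Suc n}"
    by (auto simp: paths_of_length_def vwalk_def)
  show "finite {p. set p \<subseteq> pverts G \<and> length p \<le> Suc n}"
    using assms by (rule finite_lists_length_le)
qed

lemma card_paths_of_length_Suc:
  assumes "finite (pverts G)" and "finite {w. (w, v) \<in> parcs G}" and "v \<in> pverts G"
  shows "card (paths_of_length G (Suc n) u v) =
           (\<Sum>w | (w, v) \<in> parcs G. card (paths_of_length G n u w))"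
proof -
  have "card (paths_of_length G (Suc n) u v) =
          (\<Sum>w | (w, v) \<in> parcs G. card ((\<lambda>p. p @ [v]) ` paths_of_length G n u w))"
    unfolding paths_of_length_Suc using assms
    by (subst card_UN_disjoint) (auto intro: finite_paths_of_length dest: in_paths_of_length_last)
  also have "\<dots> = (\<Sum>w | (w, v) \<in> parcs G. card (paths_of_length G n u w))"
    by (intro sum.cong refl card_image) (auto intro: inj_onI)
  finally show ?thesis .
qed

section \<open>Paths from the origin of the triangular graph\<close>

abbreviation paths_D :: "nat \<Rightarrow> nat \<Rightarrow> nat \<Rightarrow> nat \<Rightarrow> (nat \<times> nat) vwalk set" where
  "paths_D k n i j \<equiv> paths_of_length (D k) n (0, 0) (i, j)"

lemma finite_pverts_D: "finite (pverts (D k))"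
proof (rule finite_subset)
  show "pverts (D k) \<subseteq> {..k} \<times> {..k}" by (auto simp: D_def)
qed simp

lemma paths_of_length_outside: "v \<notin> pverts G \<Longrightarrow> paths_of_length G n u v = {}"
  by (auto simp: paths_of_length_def vwalk_def dest: last_in_set)

lemma paths_D_0: "paths_D k 0 i j = (if i = 0 \<and> j = 0 then {[(0, 0)]} else {})"
proof -
  have "p \<in> paths_D k 0 i j \<longleftrightarrow> p = [(0, 0)] \<and> i = 0 \<and> j = 0" for p
  proof (cases p)
    case (Cons v q)
    then show ?thesis
      by (cases q) (auto simp: paths_of_length_def vwalk_def D_def)
  qed (simp add: paths_of_length_def vwalk_def)
  then show ?thesis by auto
qed

text \<open>
  An in-neighbour \<open>(i + 1, j)\<close> outside the triangle needs no separate case, because no path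
  reaches it.
\<close>

lemma card_paths_D_Suc:
  assumes "i + j \<le> k"
  shows "card (paths_D k (Suc n) i j) =
           (if j = 0 then 0 else card (paths_D k n i (j - 1))) +
           card (paths_D k n (i + 1) j) +
           (if i = 0 then 0 else card (paths_D k n (i - 1) (j + 1)))"
proof -
  let ?A = "if j = 0 then {} else {(i, j - 1)}"
  let ?B = "{(i + 1, j)}"
  let ?C = "if i = 0 then {} else {(i - 1, j + 1)}"
  have sub: "{w. (w, (i, j)) \<in> parcs (D k)} \<subseteq> ?A \<union> ?B \<union> ?C"
    by (auto simp: D_def)
  have fin: "finite {w. (w, (i, j)) \<in> parcs (D k)}"
    by (rule finite_subset[OF sub]) auto
  have "card (paths_D k (Suc n) i j) =
          (\<Sum>w | (w, (i, j)) \<in> parcs (D k). card (paths_of_length (D k) n (0, 0) w))"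
    using assms fin by (intro card_paths_of_length_Suc finite_pverts_D) (auto simp: D_def)
  also have "\<dots> = (\<Sum>w \<in> ?A \<union> ?B \<union> ?C. card (paths_of_length (D k) n (0, 0) w))"
  proof (intro sum.mono_neutral_left sub ballI)
    fix w assume "w \<in> ?A \<union> ?B \<union> ?C - {w. (w, (i, j)) \<in> parcs (D k)}"
    then have "w \<notin> pverts (D k)"
      using assms by (auto simp: D_def split: if_splits)
    then show "card (paths_of_length (D k) n (0, 0) w) = 0"
      by (simp add: paths_of_length_outside)
  qed auto
  also have "\<dots> = (\<Sum>w \<in> ?A. card (paths_of_length (D k) n (0, 0) w)) +
      (\<Sum>w \<in> ?B. card (paths_of_length (D k) n (0, 0) w)) +
      (\<Sum>w \<in> ?C. card (paths_of_length (D k) n (0, 0) w))"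
    by (subst sum.union_disjoint, auto)+
  finally show ?thesis by simp
qed

text \<open>
  The steps \<open>(0, +1)\<close> and \<open>(+1, -1)\<close> raise \<open>2 * i + j\<close> by \<open>1\<close>, and \<open>(-1, 0)\<close> lowers it by \<open>2\<close>; the
  witness \<open>b\<close> is the number of steps of the last kind.
\<close>

lemma paths_D_nonemptyD:
  assumes "paths_D k n i j \<noteq> {}"
  shows "\<exists>b. n = 3 * b + 2 * i + j"
  using assms
proof (induction n arbitrary: i j)
  case 0
  then show ?case by (auto simp: paths_D_0 split: if_splits)
next
  case (Suc n)
  then obtain a c where arc: "((a, c), (i, j)) \<in> parcs (D k)" and "paths_D k n a c \<noteq> {}"
    unfolding paths_of_length_Suc by fastforce
  then obtain b where "n = 3 * b + 2 * a + c" using Suc.IH by blast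
  moreover have "c = j - 1 \<and> 0 < j \<and> a = i \<or> a = Suc i \<and> c = j \<or> i = Suc a \<and> c = Suc j"
    using arc by (auto simp: D_def)
  ultimately have "Suc n = 3 * b + 2 * i + j \<or> Suc n = 3 * Suc b + 2 * i + j" by auto
  then show ?case by blast
qed

section \<open>Frobenius' formula for three rows\<close>

text \<open>
  The number of standard Young tableaux of shape \<open>(b + i + j, b + i, b)\<close>.
\<close>

definition three_row_tableaux :: "nat \<Rightarrow> nat \<Rightarrow> nat \<Rightarrow> real" where
  "three_row_tableaux b i j =
     real ((i + 1) * (i + j + 2) * (j + 1)) * fact (3 * b + 2 * i + j) /
       (fact (b + i + j + 2) * fact (b + i + 1) * fact b)"

text \<open>
  Brought to the common denominator \<open>(b + i + j + 2)! * (b + i + 1)! * b!\<close>, the three summands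
  acquire the factors \<open>b + i + j + 2\<close>, \<open>b\<close> and \<open>b + i + 1\<close>, and a polynomial identity
  remains. In this form the summands vanish by themselves at \<open>j = 0\<close>, \<open>b = 0\<close> and \<open>i = 0\<close>, where
  the shape has no corner in the corresponding row.
\<close>

lemma three_row_tableaux_rec:
  assumes n: "3 * b + 2 * i + j = Suc n"
  shows "three_row_tableaux b i j =
           (if j = 0 then 0 else three_row_tableaux b i (j - 1)) +
           (if b = 0 then 0 else three_row_tableaux (b - 1) (i + 1) j) +
           (if i = 0 then 0 else three_row_tableaux b (i - 1) (j + 1))"
proof -
  define X :: real where "X = fact n / (fact (b + i + j + 2) * fact (b + i + 1) * fact b)"
  have whole: "three_row_tableaux b i j =
      real ((i + 1) * (i + j + 2) * (j + 1)) * real (3 * b + 2 * i + j) * X"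
    unfolding three_row_tableaux_def X_def n fact_Suc by simp
  have row1: "(if j = 0 then 0 else three_row_tableaux b i (j - 1)) =
      real ((i + 1) * (i + j + 1) * j) * real (b + i + j + 2) * X"
  proof (cases j)
    case (Suc m)
    have "n = 3 * b + 2 * i + m" using n Suc by simp
    then show ?thesis unfolding three_row_tableaux_def X_def Suc
      by (simp add: divide_simps add_ac)
  qed simp
  have row3: "(if b = 0 then 0 else three_row_tableaux (b - 1) (i + 1) j) =
      real ((i + 2) * (i + j + 3) * (j + 1)) * real b * X"
  proof (cases b)
    case (Suc m)
    have "n = 3 * m + 2 * (i + 1) + j" using n Suc by simp
    then show ?thesis unfolding three_row_tableaux_def X_def Suc
      by (simp add: divide_simps add_ac) (simp add: algebra_simps)
  qed simp
  have row2: "(if i = 0 then 0 else three_row_tableaux b (i - 1) (j + 1)) =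
      real (i * (i + j + 2) * (j + 2)) * real (b + i + 1) * X"
  proof (cases i)
    case (Suc m)
    have "n = 3 * b + 2 * m + (j + 1)" using n Suc by simp
    then show ?thesis unfolding three_row_tableaux_def X_def Suc
      by (simp add: divide_simps add_ac)
  qed simp
  show ?thesis unfolding whole row1 row2 row3 by (simp add: algebra_simps)
qed

section \<open>Counting the paths\<close>

lemma card_paths_D:
  assumes "3 * b + 2 * i + j = n" and "n \<le> k"
  shows "real (card (paths_D k n i j)) = three_row_tableaux b i j"
  using assms
proof (induction n arbitrary: b i j)
  case 0
  then have "b = 0" "i = 0" "j = 0" by linarith+
  then show ?case by (simp add: paths_D_0 three_row_tableaux_def)
next
  case (Suc n)
  have up: "real (card (paths_D k n i (j - 1))) = three_row_tableaux b i (j - 1)" if "j \<noteq> 0"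
    using Suc.prems that by (intro Suc.IH; linarith)
  have left: "real (card (paths_D k n (i + 1) j)) =
      (if b = 0 then 0 else three_row_tableaux (b - 1) (i + 1) j)"
  proof (cases "b = 0")
    case True
    \<comment> \<open>Reaching \<open>(i + 1, j)\<close> takes at least \<open>2 * (i + 1) + j\<close> steps, but \<open>n = 2 * i + j - 1\<close>.\<close>
    with Suc.prems(1) have "n < 2 * (i + 1) + j" by presburger
    then have "paths_D k n (i + 1) j = {}"
      using paths_D_nonemptyD[of k n "i + 1" j] by linarith
    with True show ?thesis by simp
  next
    case False
    then obtain m where m: "b = Suc m" by (cases b) auto
    have "3 * m + 2 * (i + 1) + j = n" using Suc.prems(1) unfolding m by simp
    from Suc.IH[OF this] Suc.prems(2) m show ?thesis by simp
  qed
  have diag: "real (card (paths_D k n (i - 1) (j + 1))) = three_row_tableaux b (i - 1) (j + 1)"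
    if "i \<noteq> 0"
    using Suc.prems that by (intro Suc.IH; linarith)
  have "i + j \<le> k" using Suc.prems by linarith
  then show ?case
    unfolding three_row_tableaux_rec[OF Suc.prems(1)] card_paths_D_Suc[OF \<open>i + j \<le> k\<close>]
      of_nat_add left
    using up diag by (auto simp only: of_nat_0 split: if_split)
qed

theorem proposition3:
  fixes n k i j :: nat
  assumes "n \<le> k"
  shows "(3 dvd n + i + 2 * j \<and> 2 * i + j \<le> n \<longrightarrow>
            real (card (paths_of_length (D k) n (0, 0) (i, j))) =
              real ((i + 1) * (i + j + 2) * (j + 1)) * fact n /
                (fact ((n + i + 2 * j + 6) div 3) *
                 fact ((n + i + 3 - j) div 3) *
                 fact ((n - 2 * i - j) div 3))) \<and>
         (\<not> (3 dvd n + i + 2 * j \<and> 2 * i + j \<le> n) \<longrightarrow>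
            paths_of_length (D k) n (0, 0) (i, j) = {})"
proof (intro conjI impI)
  assume "3 dvd n + i + 2 * j \<and> 2 * i + j \<le> n"
  then have "\<exists>b. n = 3 * b + 2 * i + j" by presburger
  then obtain b where b: "n = 3 * b + 2 * i + j" by blast
  have "(n + i + 2 * j + 6) div 3 = b + i + j + 2" "(n + i + 3 - j) div 3 = b + i + 1"
    "(n - 2 * i - j) div 3 = b"
    unfolding b by presburger+
  then show "real (card (paths_of_length (D k) n (0, 0) (i, j))) =
      real ((i + 1) * (i + j + 2) * (j + 1)) * fact n /
        (fact ((n + i + 2 * j + 6) div 3) * fact ((n + i + 3 - j) div 3) *
         fact ((n - 2 * i - j) div 3))"
    using card_paths_D[OF b[symmetric] assms] b by (simp only: three_row_tableaux_def)
next
  assume none: "\<not> (3 dvd n + i + 2 * j \<and> 2 * i + j \<le> n)"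
  have "3 dvd n + i + 2 * j \<and> 2 * i + j \<le> n" if "n = 3 * b + 2 * i + j" for b
    unfolding that by presburger
  with none show "paths_of_length (D k) n (0, 0) (i, j) = {}"
    using paths_D_nonemptyD by blast
qed

end
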